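(* Let $\bar f_j\in\mathbb{R}_+$ and $\underline f_j=-\bar f_j$ for $j\in\{1,\dots,n\}$, $\underline f_0\le\bar f_0$, $d\in\mathbb{R}$, $x_0:=1$, and let $$\mathcal{S}=\Big\{(x,f)\in\{0,1\}^n\times\mathbb{R}^{n+1}:\ \sum_{j=0}^n f_j=d,\ \ \underline f_j x_j\le f_j\le \bar f_j x_j,\ j\in\{0,1,\dots,n\}\Big\}.$$ Let $N=(\bigcup_{i=-1}^n K_i,A)$ be the layered network associated with $\mathcal{S}$ (constructed as in the context). Then $\operatorname{conv}(\mathcal{S})$ is the set of all $(x,f)\in[0,1]^n\times\mathbb{R}^{n+1}$ for which there exist $Y_{\eta,\eta'}\ge 0$, one for each arc $(\eta\to\eta')\in A$, such that \begin{align*} &\sum_{\eta\in K_0}Y_{(-1,0,\emptyset),\eta}=1,\\ &\sum_{\eta\in K_{i-1}}Y_{\eta,\eta'}=\sum_{\eta''\in K_{i+1}}Y_{\eta',\eta''}, && i\in\{0,\dots,n-1\},\ \eta'\in K_i,\\ &x_i=1-\sum_{(i-1,\delta,S)\in K_{i-1},\,(i,\delta,S)\in K_i}Y_{(i-1,\delta,S),(i,\delta,S)}, && i\in\{1,\dots,n\},\\ &f_i=\sum_{(i-1,\delta,S)\in K_{i-1},\,(i,\delta',S')\in K_i}(\delta'-\delta)\,Y_{(i-1,\delta,S),(i,\delta',S')}, && i\in\{0,\dots,n\}, \end{align*} where every sum ranges only over pairs that are arcs in $A$.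
   Context: Coordinates: $x=(x_1,\dots,x_n)$, $f=(f_0,\dots,f_n)$; $x_0$ is the constant $1$. Definitions: let $E_0=\{\underline f_0,\bar f_0\}$ and $E_j=\{-\bar f_j,0,\bar f_j\}$ for $j\in\{1,\dots,n\}$. For $k\in\{0,\dots,n\}$ let $$V_k=\Big\{f_k=d-\sum_{j\in\{0,\dots,n\}\setminus\{k\}}f_j:\ f_j\in E_j\ \text{for } j\ne k,\ \ \underline f_k\le f_k\le\bar f_k\Big\}.$$ Network construction: nodes are triplets $(i,\delta,S)$, with layer index $i\in\{-1,0,\dots,n\}$, $\delta\in\mathbb{R}$, and $S\subseteq\{0,\dots,n\}$ with $|S|\le1$. Start with $K_{-1}=\{(-1,0,\emptyset)\}$ (the source), $K_i=\emptyset$ for $i=0,\dots,n$, and $A=\emptyset$. For $i=0,1,\dots,n$ in order, set $$\underline B_i=\max\Big\{\sum_{j=0}^i\underline f_j,\ d-\sum_{j=i+1}^n\bar f_j\Big\},\qquad \overline B_i=\min\Big\{\sum_{j=0}^i\bar f_j,\ d-\sum_{j=i+1}^n\underline f_j\Big\},$$ and for each node $(i-1,\delta,S)\in K_{i-1}$ do the following: (1) for each $\vartheta\in E_i$ with $\underline B_i\le\delta+\vartheta\le\overline B_i$, add the node $(i,\delta+\vartheta,S)$ to $K_i$ and the arc $(i-1,\delta,S)\to(i,\delta+\vartheta,S)$ to $A$; (2) if $S=\emptyset$, then for each $\vartheta\in V_i$ with $\underline B_i\le\delta+\vartheta\le\overline B_i$, add the node $(i,\delta+\vartheta,\{i\})$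 to $K_i$ and the arc $(i-1,\delta,\emptyset)\to(i,\delta+\vartheta,\{i\})$ to $A$. The sets $K_i$ and $A$ are sets (no repetitions).
   Formalization: The bounds \bar f_j (j=1,…,n) are taken strictly positive; with \bar f_j=0 allowed the claim fails, e.g. n=1, \bar f_1=0, \underline f_0=0, \bar f_0=1, d=1/2, where the network forces x_1=0 but conv(S) contains x_1=1. *)

theory Defs
  imports "HOL-Analysis.Analysis" "HOL-Library.Function_Algebras"
begin

text \<open>
  Vectors whose dimension depends on a natural number are functions on \<open>nat\<close> that vanish
  outside a finite index set. Making functions a real vector space allows the library's
  \<open>convex hull\<close> to be applied to sets of such vectors.
\<close>

instantiation "fun" :: (type, real_vector) real_vector
begin

definition scaleR_fun :: "real \<Rightarrow> ('a \<Rightarrow> 'b) \<Rightarrow> 'a \<Rightarrow> 'b" where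
  "scaleR_fun c f = (\<lambda>x. c *\<^sub>R f x)"

instance
  by standard (simp_all add: scaleR_fun_def plus_fun_def scaleR_add_right scaleR_add_left)

end

lemma scaleR_fun_apply [simp]: "(c *\<^sub>R f) x = c *\<^sub>R f x"
  by (simp add: scaleR_fun_def)

text \<open>The space of real vectors with coordinates indexed by \<open>I\<close>.\<close>

definition vectors_on :: "nat set \<Rightarrow> (nat \<Rightarrow> real) set" where
  "vectors_on I = {v. \<forall>i. i \<notin> I \<longrightarrow> v i = 0}"

text \<open>
  Throughout, \<open>flo\<close> and \<open>fhi\<close> are the lower and upper flow bounds. In the following
  set, \<open>x(0 := 1)\<close> implements the convention that coordinate 0 of \<open>x\<close> is the constant 1;
  \<open>x\<close> itself only has the coordinates \<open>1, \<dots>, n\<close>.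
\<close>

definition flow_set ::
  "nat \<Rightarrow> (nat \<Rightarrow> real) \<Rightarrow> (nat \<Rightarrow> real) \<Rightarrow> real \<Rightarrow> ((nat \<Rightarrow> real) \<times> (nat \<Rightarrow> real)) set" where
  "flow_set n flo fhi d =
     {(x, f). x \<in> vectors_on {1..n} \<and> (\<forall>j\<in>{1..n}. x j \<in> {0, 1}) \<and>
              f \<in> vectors_on {0..n} \<and>
              (\<Sum>j=0..n. f j) = d \<and>
              (\<forall>j\<in>{0..n}. flo j * (x(0 := 1)) j \<le> f j \<and> f j \<le> fhi j * (x(0 := 1)) j)}"

definition extreme_values :: "(nat \<Rightarrow> real) \<Rightarrow> (nat \<Rightarrow> real) \<Rightarrow> nat \<Rightarrow> real set" where
  "extreme_values flo fhi j = (if j = 0 then {flo 0, fhi 0} else {- fhi j, 0, fhi j})"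

definition balancing_values ::
  "nat \<Rightarrow> (nat \<Rightarrow> real) \<Rightarrow> (nat \<Rightarrow> real) \<Rightarrow> real \<Rightarrow> nat \<Rightarrow> real set" where
  "balancing_values n flo fhi d k =
     {v. \<exists>f. (\<forall>j\<in>{0..n} - {k}. f j \<in> extreme_values flo fhi j) \<and>
             v = d - (\<Sum>j\<in>{0..n} - {k}. f j) \<and> flo k \<le> v \<and> v \<le> fhi k}"

definition lower_partial ::
  "nat \<Rightarrow> (nat \<Rightarrow> real) \<Rightarrow> (nat \<Rightarrow> real) \<Rightarrow> real \<Rightarrow> nat \<Rightarrow> real" where
  "lower_partial n flo fhi d i = max (\<Sum>j=0..i. flo j) (d - (\<Sum>j=i+1..n. fhi j))"

definition upper_partial ::
  "nat \<Rightarrow> (nat \<Rightarrow> real) \<Rightarrow> (nat \<Rightarrow> real) \<Rightarrow> real \<Rightarrow> nat \<Rightarrow> real" where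
  "upper_partial n flo fhi d i = min (\<Sum>j=0..i. fhi j) (d - (\<Sum>j=i+1..n. flo j))"

text \<open>Nodes are triplets of a layer index (from -1 on), a partial sum, and a set of indices.\<close>

type_synonym node = "int \<times> real \<times> nat set"

definition source :: node where
  "source = (-1, 0, {})"

text \<open>The arcs created in step \<open>i\<close> of the construction, when layer \<open>i - 1\<close> is \<open>L\<close>.\<close>

definition step_arcs ::
  "nat \<Rightarrow> (nat \<Rightarrow> real) \<Rightarrow> (nat \<Rightarrow> real) \<Rightarrow> real \<Rightarrow> nat \<Rightarrow> node set \<Rightarrow> (node \<times> node) set" where
  "step_arcs n flo fhi d i L =
     {((int i - 1, \<delta>, S), (int i, \<delta> + \<theta>, S)) | \<delta> S \<theta>.
        (int i - 1, \<delta>, S) \<in> L \<and> \<theta> \<in> extreme_values flo fhi i \<and>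
        lower_partial n flo fhi d i \<le> \<delta> + \<theta> \<and> \<delta> + \<theta> \<le> upper_partial n flo fhi d i} \<union>
     {((int i - 1, \<delta>, {}), (int i, \<delta> + \<theta>, {i})) | \<delta> \<theta>.
        (int i - 1, \<delta>, {}) \<in> L \<and> \<theta> \<in> balancing_values n flo fhi d i \<and>
        lower_partial n flo fhi d i \<le> \<delta> + \<theta> \<and> \<delta> + \<theta> \<le> upper_partial n flo fhi d i}"

text \<open>\<open>layers n flo fhi d m\<close> is the layer with index \<open>m - 1\<close>: indices are shifted by one here,
  and shifted back in \<open>layer\<close> below.\<close>

primrec layers ::
  "nat \<Rightarrow> (nat \<Rightarrow> real) \<Rightarrow> (nat \<Rightarrow> real) \<Rightarrow> real \<Rightarrow> nat \<Rightarrow> node set" where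
  "layers n flo fhi d 0 = {source}"
| "layers n flo fhi d (Suc i) = snd ` step_arcs n flo fhi d i (layers n flo fhi d i)"

definition layer ::
  "nat \<Rightarrow> (nat \<Rightarrow> real) \<Rightarrow> (nat \<Rightarrow> real) \<Rightarrow> real \<Rightarrow> int \<Rightarrow> node set" where
  "layer n flo fhi d i = (if -1 \<le> i \<and> i \<le> int n then layers n flo fhi d (nat (i + 1)) else {})"

definition network_arcs ::
  "nat \<Rightarrow> (nat \<Rightarrow> real) \<Rightarrow> (nat \<Rightarrow> real) \<Rightarrow> real \<Rightarrow> (node \<times> node) set" where
  "network_arcs n flo fhi d =
     (\<Union>i\<in>{0..n}. step_arcs n flo fhi d i (layer n flo fhi d (int i - 1)))"

end

theory Submission
  imports Defs
begin

text \<open>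
  Assign to each arc of layer \<open>i\<close> the vector that changes only the coordinates \<open>x\<^sub>i\<close> and
  \<open>f\<^sub>i\<close>: the flow \<open>f\<^sub>i\<close> is the difference of the partial sums at its ends, and \<open>x\<^sub>i\<close> is 1 unless
  the arc is idle, that is, changes neither the partial sum nor the mark (\<open>arc_vector\<close>).
  A unit flow \<open>Y\<close> sends one unit through every layer, so the equations for \<open>x\<close> and \<open>f\<close>
  say precisely that \<open>(x, f)\<close> is the \<open>Y\<close>-weighted sum of the arc vectors (\<open>eq_flow_vector_iff\<close>).
  The claim becomes: the convex hull of the flow set is the set of these weighted sums.

  Every weighted sum lies in the hull. Along any path the arc vectors add up to a pair that satisfies
  the bounds in every coordinate passed so far, and whose flows sum to the partial sum of the node
  reached (\<open>partial_solutions_extend\<close>). The bounds on partial sums force the value \<open>d\<close> in the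
  last layer, so whole paths give points of the flow set. A unit flow is a convex combination of
  paths; instead of decomposing it, \<open>flow_vector_in_convex_hull\<close> carries one mean point
  per node from layer to layer, the mean of all path vectors that reach the node.

  Conversely, the weighted sums form a convex set, so it suffices to reach enough points of the
  flow set. For fixed \<open>x\<close>, the admissible \<open>f\<close> form a box intersected with a hyperplane, and
  each of them is a convex combination of points with at most one coordinate strictly between its bounds
  (\<open>box_slice_in_hull_of_tight_points\<close>). For such a point, follow the partial sums of
  \<open>f\<close> and set the mark at the exceptional coordinate, whose flow is a balancing value because
  all the others are extreme. This is a path in the network, and the indicator function of
  its arcs is a unit flow with weighted sum \<open>(x, f)\<close> (\<open>tight_solution_is_flow_vector\<close>).
\<close>

section \<open>Unit flows in layered networks\<close>

text \<open>
  The mean is stated without dividing by the total weight, so that weight zero needs no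
  separate treatment where the lemma is used; any point of \<open>C\<close> serves then, which is why
  \<open>F\<close> must not be empty.
\<close>

lemma convex_weighted_mean:
  fixes r :: "'a \<Rightarrow> 'v::real_vector"
  assumes "convex C" "finite F" "F \<noteq> {}" "\<And>a. a \<in> F \<Longrightarrow> Y a \<ge> 0" "\<And>a. a \<in> F \<Longrightarrow> r a \<in> C"
  shows "\<exists>p\<in>C. (\<Sum>a\<in>F. Y a *\<^sub>R r a) = (\<Sum>a\<in>F. Y a) *\<^sub>R p"
proof (cases "(\<Sum>a\<in>F. Y a) = 0")
  case True
  then have "\<forall>a\<in>F. Y a = 0"
    using sum_nonneg_eq_0_iff[of F Y] assms by auto
  moreover obtain a where "a \<in> F" using assms by blast
  ultimately show ?thesis using assms by (intro bexI[of _ "r a"]) simp_all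
next
  case False
  let ?W = "\<Sum>a\<in>F. Y a"
  have "?W > 0" using False sum_nonneg[of F Y] assms by force
  then have "(\<Sum>a\<in>F. (Y a / ?W) *\<^sub>R r a) \<in> C"
    using assms by (intro convex_sum) (auto simp flip: sum_divide_distrib)
  moreover have "?W *\<^sub>R (\<Sum>a\<in>F. (Y a / ?W) *\<^sub>R r a) = (\<Sum>a\<in>F. Y a *\<^sub>R r a)"
    using False by (simp add: scaleR_sum_right)
  ultimately show ?thesis by metis
qed

text \<open>
  Every node after the source is the head of an arc, hence reachable. Disjointness of the
  layers lets a single weight function on pairs of nodes serve all layers.
\<close>

locale layered_network =
  fixes L :: "nat \<Rightarrow> 'a set" and E :: "nat \<Rightarrow> ('a \<times> 'a) set" and s :: 'a
  assumes L_0: "L 0 = {s}"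
    and E_sub: "E i \<subseteq> L i \<times> L (Suc i)"
    and L_Suc: "L (Suc i) = snd ` E i"
    and finite_E: "finite (E i)"
    and L_disjoint: "i \<noteq> j \<Longrightarrow> L i \<inter> L j = {}"
begin

definition unit_flow :: "nat \<Rightarrow> ('a \<times> 'a \<Rightarrow> real) \<Rightarrow> bool" where
  "unit_flow M Y \<longleftrightarrow>
     (\<forall>i<M. \<forall>a\<in>E i. Y a \<ge> 0) \<and> (\<Sum>a\<in>E 0. Y a) = 1 \<and>
     (\<forall>i. Suc i < M \<longrightarrow> (\<forall>v\<in>L (Suc i).
        (\<Sum>a | a \<in> E i \<and> snd a = v. Y a) = (\<Sum>a | a \<in> E (Suc i) \<and> fst a = v. Y a)))"

definition flow_vector ::
  "(nat \<Rightarrow> 'a \<times> 'a \<Rightarrow> 'v::real_vector) \<Rightarrow> nat \<Rightarrow> ('a \<times> 'a \<Rightarrow> real) \<Rightarrow> 'v" where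
  "flow_vector g M Y = (\<Sum>i<M. \<Sum>a\<in>E i. Y a *\<^sub>R g i a)"

lemma finite_L: "finite (L i)"
  by (cases i) (simp_all add: L_0 L_Suc finite_E)

lemma sum_by_head: "(\<Sum>v\<in>L (Suc i). \<Sum>a | a \<in> E i \<and> snd a = v. h a) = (\<Sum>a\<in>E i. h a)"
  for h :: "'a \<times> 'a \<Rightarrow> 'b::comm_monoid_add"
  using sum.group[OF finite_E finite_L, of snd i "Suc i" h] by (simp add: L_Suc)

lemma sum_by_tail: "(\<Sum>v\<in>L i. \<Sum>a | a \<in> E i \<and> fst a = v. h a) = (\<Sum>a\<in>E i. h a)"
  for h :: "'a \<times> 'a \<Rightarrow> 'b::comm_monoid_add"
  using sum.group[OF finite_E finite_L, of fst i i h] E_sub[of i] by fastforce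

text \<open>
  Grouping the arcs of two consecutive layers by their common node turns conservation at
  every node into equality of the layer totals.
\<close>

lemma unit_flow_layer_total:
  assumes "unit_flow M Y" "i < M"
  shows "(\<Sum>a\<in>E i. Y a) = 1"
  using assms(2)
proof (induction i)
  case 0
  then show ?case using assms by (simp add: unit_flow_def)
next
  case (Suc i)
  have "(\<Sum>a\<in>E (Suc i). Y a) = (\<Sum>v\<in>L (Suc i). \<Sum>a | a \<in> E (Suc i) \<and> fst a = v. Y a)"
    by (simp add: sum_by_tail)
  also have "\<dots> = (\<Sum>v\<in>L (Suc i). \<Sum>a | a \<in> E i \<and> snd a = v. Y a)"
    using assms(1) Suc.prems by (intro sum.cong[OF refl, of "L (Suc i)"]) (simp add: unit_flow_def)
  also have "\<dots> = 1" using Suc by (simp add: sum_by_head)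
  finally show ?case .
qed

text \<open>
  The inductive step of the flow decomposition. If \<open>q u\<close> is an average of vectors of paths ending at
  \<open>u\<close>, then \<open>q u + g (u, v)\<close> is an average of vectors of paths ending at \<open>v\<close>; the mean over
  all arcs into \<open>v\<close>, weighted by \<open>Y\<close>, is the new point at \<open>v\<close>.
\<close>

lemma propagate_mean_points:
  fixes g :: "'a \<times> 'a \<Rightarrow> 'v::real_vector"
  assumes nonneg: "\<And>a. a \<in> E i \<Longrightarrow> Y a \<ge> 0"
    and closed: "\<And>u v z. (u, v) \<in> E i \<Longrightarrow> z \<in> P u \<Longrightarrow> z + g (u, v) \<in> P' v"
    and q: "\<And>v. v \<in> L i \<Longrightarrow> q v \<in> convex hull P v"
  shows "\<exists>p. (\<forall>v\<in>L (Suc i). p v \<in> convex hull P' v) \<and>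
    (\<Sum>v\<in>L (Suc i). (\<Sum>a | a \<in> E i \<and> snd a = v. Y a) *\<^sub>R p v)
      = (\<Sum>a\<in>E i. Y a *\<^sub>R (q (fst a) + g a))"
proof -
  have hull_closed: "q u + g (u, v) \<in> convex hull P' v" if "(u, v) \<in> E i" for u v
  proof -
    have "g (u, v) + q u \<in> (+) (g (u, v)) ` (convex hull P u)"
      using q E_sub that by blast
    also have "\<dots> = convex hull ((+) (g (u, v)) ` P u)"
      by (rule convex_hull_translation[symmetric])
    also have "\<dots> \<subseteq> convex hull P' v"
      using closed[OF that] by (intro hull_mono) (auto simp: add.commute)
    finally show ?thesis by (simp add: add.commute)
  qed
  have "\<exists>z\<in>convex hull P' v. (\<Sum>a | a \<in> E i \<and> snd a = v. Y a *\<^sub>R (q (fst a) + g a))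
      = (\<Sum>a | a \<in> E i \<and> snd a = v. Y a) *\<^sub>R z" if "v \<in> L (Suc i)" for v
    using that nonneg hull_closed
    by (intro convex_weighted_mean) (auto simp: finite_E L_Suc)
  then have "\<exists>p. \<forall>v\<in>L (Suc i). p v \<in> convex hull P' v \<and>
      (\<Sum>a | a \<in> E i \<and> snd a = v. Y a *\<^sub>R (q (fst a) + g a))
        = (\<Sum>a | a \<in> E i \<and> snd a = v. Y a) *\<^sub>R p v"
    by (intro bchoice) blast
  then obtain p where p: "\<And>v. v \<in> L (Suc i) \<Longrightarrow> p v \<in> convex hull P' v"
      "\<And>v. v \<in> L (Suc i) \<Longrightarrow> (\<Sum>a | a \<in> E i \<and> snd a = v. Y a *\<^sub>R (q (fst a) + g a))
        = (\<Sum>a | a \<in> E i \<and> snd a = v. Y a) *\<^sub>R p v"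
    by blast
  have "(\<Sum>v\<in>L (Suc i). (\<Sum>a | a \<in> E i \<and> snd a = v. Y a) *\<^sub>R p v)
      = (\<Sum>v\<in>L (Suc i). \<Sum>a | a \<in> E i \<and> snd a = v. Y a *\<^sub>R (q (fst a) + g a))"
    by (intro sum.cong[OF refl, of "L (Suc i)"]) (rule p(2)[symmetric])
  also have "\<dots> = (\<Sum>a\<in>E i. Y a *\<^sub>R (q (fst a) + g a))"
    by (rule sum_by_head)
  finally show ?thesis using p(1) by blast
qed

text \<open>
  Flow decomposition in convex form: \<open>P i v\<close> may be any set containing the vectors of all
  paths from the source to \<open>v\<close>. The mean points at the nodes of a layer, weighted with the inflows,
  add up to the part of the flow vector collected so far. In the last layer the inflows
  sum to 1, so this is a convex combination.
\<close>

theorem flow_vector_in_convex_hull: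
  fixes g :: "nat \<Rightarrow> 'a \<times> 'a \<Rightarrow> 'v::real_vector"
  assumes flow: "unit_flow (Suc n) Y"
    and start: "0 \<in> P 0 s"
    and closed: "\<And>i u v z. i \<le> n \<Longrightarrow> (u, v) \<in> E i \<Longrightarrow> z \<in> P i u \<Longrightarrow> z + g i (u, v) \<in> P (Suc i) v"
  shows "flow_vector g (Suc n) Y \<in> convex hull (\<Union>v\<in>L (Suc n). P (Suc n) v)"
proof -
  have nonneg: "Y a \<ge> 0" if "a \<in> E i" "i \<le> n" for a i
    using flow that by (auto simp: unit_flow_def less_Suc_eq_le)
  have "\<exists>p. (\<forall>v\<in>L (Suc m). p v \<in> convex hull P (Suc m) v) \<and>
      (\<Sum>v\<in>L (Suc m). (\<Sum>a | a \<in> E m \<and> snd a = v. Y a) *\<^sub>R p v) = flow_vector g (Suc m) Y"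
    if "m \<le> n" for m
    using that
  proof (induction m)
    case 0
    have "\<exists>p. (\<forall>v\<in>L (Suc 0). p v \<in> convex hull P (Suc 0) v) \<and>
        (\<Sum>v\<in>L (Suc 0). (\<Sum>a | a \<in> E 0 \<and> snd a = v. Y a) *\<^sub>R p v)
          = (\<Sum>a\<in>E 0. Y a *\<^sub>R ((\<lambda>_. 0) (fst a) + g 0 a))"
      using nonneg closed start
      by (intro propagate_mean_points[where P = "P 0"]) (auto simp: L_0 hull_inc)
    then show ?case by (simp add: flow_vector_def)
  next
    case (Suc m)
    then obtain q where q: "\<forall>v\<in>L (Suc m). q v \<in> convex hull P (Suc m) v"
        "(\<Sum>v\<in>L (Suc m). (\<Sum>a | a \<in> E m \<and> snd a = v. Y a) *\<^sub>R q v) = flow_vector g (Suc m) Y"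
      by auto
    \<comment> \<open>By conservation, the weights of the mean points may be read as outflows instead of inflows.\<close>
    have "(\<Sum>a\<in>E (Suc m). Y a *\<^sub>R q (fst a))
        = (\<Sum>v\<in>L (Suc m). \<Sum>a | a \<in> E (Suc m) \<and> fst a = v. Y a *\<^sub>R q (fst a))"
      by (rule sum_by_tail[symmetric])
    also have "\<dots> = (\<Sum>v\<in>L (Suc m). (\<Sum>a | a \<in> E (Suc m) \<and> fst a = v. Y a) *\<^sub>R q v)"
      by (intro sum.cong refl) (simp add: scaleR_sum_left)
    also have "\<dots> = (\<Sum>v\<in>L (Suc m). (\<Sum>a | a \<in> E m \<and> snd a = v. Y a) *\<^sub>R q v)"
      using flow Suc.prems by (intro sum.cong refl) (simp add: unit_flow_def)
    finally have "(\<Sum>a\<in>E (Suc m). Y a *\<^sub>R (q (fst a) + g (Suc m) a)) = flow_vector g (Suc (Suc m)) Y"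
      using q by (simp add: flow_vector_def scaleR_add_right sum.distrib)
    moreover have "\<exists>p. (\<forall>v\<in>L (Suc (Suc m)). p v \<in> convex hull P (Suc (Suc m)) v) \<and>
        (\<Sum>v\<in>L (Suc (Suc m)). (\<Sum>a | a \<in> E (Suc m) \<and> snd a = v. Y a) *\<^sub>R p v)
          = (\<Sum>a\<in>E (Suc m). Y a *\<^sub>R (q (fst a) + g (Suc m) a))"
      using nonneg closed Suc.prems q
      by (intro propagate_mean_points[where P = "P (Suc m)"]) auto
    ultimately show ?case by simp
  qed
  from this[of n] obtain p where p: "\<forall>v\<in>L (Suc n). p v \<in> convex hull P (Suc n) v"
      "(\<Sum>v\<in>L (Suc n). (\<Sum>a | a \<in> E n \<and> snd a = v. Y a) *\<^sub>R p v) = flow_vector g (Suc n) Y"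
    by auto
  have "(\<Sum>v\<in>L (Suc n). (\<Sum>a | a \<in> E n \<and> snd a = v. Y a) *\<^sub>R p v)
      \<in> convex hull (\<Union>v\<in>L (Suc n). P (Suc n) v)"
  proof (intro convex_sum finite_L convex_convex_hull)
    show "(\<Sum>v\<in>L (Suc n). \<Sum>a | a \<in> E n \<and> snd a = v. Y a) = 1"
      using unit_flow_layer_total[OF flow, of n] by (simp add: sum_by_head)
    show "0 \<le> (\<Sum>a | a \<in> E n \<and> snd a = v. Y a)" for v
      using nonneg by (intro sum_nonneg) auto
    show "p v \<in> convex hull (\<Union>v\<in>L (Suc n). P (Suc n) v)" if "v \<in> L (Suc n)" for v
      using p(1) that hull_mono[of "P (Suc n) v" "\<Union>v\<in>L (Suc n). P (Suc n) v" convex] by blast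
  qed
  with p(2) show ?thesis by simp
qed

lemma convex_flow_vectors: "convex (flow_vector g M ` {Y. unit_flow M Y})"
proof (rule convexI)
  fix y z :: 'b and u v :: real
  assume y: "y \<in> flow_vector g M ` {Y. unit_flow M Y}" and z: "z \<in> flow_vector g M ` {Y. unit_flow M Y}"
    and uv: "0 \<le> u" "0 \<le> v" "u + v = 1"
  then obtain Y Z where YZ: "unit_flow M Y" "y = flow_vector g M Y" "unit_flow M Z" "z = flow_vector g M Z"
    by auto
  let ?W = "\<lambda>a. u * Y a + v * Z a"
  have "unit_flow M ?W"
    unfolding unit_flow_def
  proof (intro conjI allI impI ballI)
    show "0 \<le> ?W a" if "i < M" "a \<in> E i" for i a
      using YZ uv that by (simp add: unit_flow_def)
    show "(\<Sum>a\<in>E 0. ?W a) = 1"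
      using YZ uv by (simp add: unit_flow_def sum.distrib flip: sum_distrib_left)
    show "(\<Sum>a | a \<in> E i \<and> snd a = w. ?W a) = (\<Sum>a | a \<in> E (Suc i) \<and> fst a = w. ?W a)"
      if "Suc i < M" "w \<in> L (Suc i)" for i w
      using YZ(1,3) that by (simp add: unit_flow_def sum.distrib flip: sum_distrib_left)
  qed
  moreover have "flow_vector g M ?W = u *\<^sub>R y + v *\<^sub>R z"
    by (simp add: YZ flow_vector_def sum.distrib scaleR_sum_right scaleR_add_left)
  ultimately show "u *\<^sub>R y + v *\<^sub>R z \<in> flow_vector g M ` {Y. unit_flow M Y}"
    by (metis (mono_tags) imageI mem_Collect_eq)
qed

text \<open>
  The flow is the indicator function of the path. As layers are disjoint, the path has exactly one
  arc in each layer, so every sum over a layer has a single nonzero term.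
\<close>

lemma path_is_unit_flow:
  fixes g :: "nat \<Rightarrow> 'a \<times> 'a \<Rightarrow> 'v::real_vector"
  assumes path: "\<And>i. i < M \<Longrightarrow> (\<nu> i, \<nu> (Suc i)) \<in> E i" and "M > 0"
  shows "(\<Sum>i<M. g i (\<nu> i, \<nu> (Suc i))) \<in> flow_vector g M ` {Y. unit_flow M Y}"
proof -
  define Y :: "'a \<times> 'a \<Rightarrow> real" where
    "Y a = (if \<exists>i<M. a = (\<nu> i, \<nu> (Suc i)) then 1 else 0)" for a
  have Y: "Y a = (if a = (\<nu> i, \<nu> (Suc i)) then 1 else 0)" if "a \<in> E i" "i < M" for a i
  proof -
    have "j = i" if "a = (\<nu> j, \<nu> (Suc j))" "j < M" for j
      using that path[of j] \<open>a \<in> E i\<close> E_sub[of i] E_sub[of j] L_disjoint[of i j] by blast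
    then have "(\<exists>j<M. a = (\<nu> j, \<nu> (Suc j))) \<longleftrightarrow> a = (\<nu> i, \<nu> (Suc i))"
      using that(2) by blast
    then show ?thesis unfolding Y_def by presburger
  qed
  have sum_Y: "(\<Sum>a\<in>B. Y a) = (if (\<nu> i, \<nu> (Suc i)) \<in> B then 1 else 0)"
    if "B \<subseteq> E i" "i < M" for B i
  proof -
    have "(\<Sum>a\<in>B. Y a) = (\<Sum>a\<in>B. if a = (\<nu> i, \<nu> (Suc i)) then 1 else 0)"
      using that by (intro sum.cong refl Y) auto
    also have "\<dots> = (if (\<nu> i, \<nu> (Suc i)) \<in> B then 1 else 0)"
      using finite_subset[OF that(1) finite_E] by (simp add: sum.delta)
    finally show ?thesis .
  qed
  have "unit_flow M Y"
    unfolding unit_flow_def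
  proof (intro conjI allI impI ballI)
    show "0 \<le> Y a" for a by (simp add: Y_def)
    show "(\<Sum>a\<in>E 0. Y a) = 1" using path[of 0] \<open>M > 0\<close> by (simp add: sum_Y[of _ 0])
    show "(\<Sum>a | a \<in> E i \<and> snd a = v. Y a) = (\<Sum>a | a \<in> E (Suc i) \<and> fst a = v. Y a)"
      if "Suc i < M" for i v
      using that path[of i] path[of "Suc i"] by (simp add: sum_Y[of _ i] sum_Y[of _ "Suc i"])
  qed
  moreover have "flow_vector g M Y = (\<Sum>i<M. g i (\<nu> i, \<nu> (Suc i)))"
    unfolding flow_vector_def
  proof (intro sum.cong refl)
    fix i assume "i \<in> {..<M}"
    then have "(\<Sum>a\<in>E i. Y a *\<^sub>R g i a)
        = (\<Sum>a\<in>E i. if a = (\<nu> i, \<nu> (Suc i)) then g i a else 0)"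
      using Y[of _ i] by (intro sum.cong refl) simp
    then show "(\<Sum>a\<in>E i. Y a *\<^sub>R g i a) = g i (\<nu> i, \<nu> (Suc i))"
      using path[of i] \<open>i \<in> {..<M}\<close> by (simp add: sum.delta finite_E)
  qed
  ultimately show ?thesis by (metis (mono_tags) imageI mem_Collect_eq)
qed

end

section \<open>Hyperplane slices of boxes\<close>

definition box_slice ::
  "'a set \<Rightarrow> ('a \<Rightarrow> real) \<Rightarrow> ('a \<Rightarrow> real) \<Rightarrow> real \<Rightarrow> ('a \<Rightarrow> real) set" where
  "box_slice I lo hi d =
     {f. (\<forall>i. i \<notin> I \<longrightarrow> f i = 0) \<and> (\<Sum>i\<in>I. f i) = d \<and> (\<forall>i\<in>I. lo i \<le> f i \<and> f i \<le> hi i)}"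

definition slack ::
  "'a set \<Rightarrow> ('a \<Rightarrow> real) \<Rightarrow> ('a \<Rightarrow> real) \<Rightarrow> ('a \<Rightarrow> real) \<Rightarrow> 'a set" where
  "slack I lo hi f = {i\<in>I. lo i < f i \<and> f i < hi i}"

text \<open>
  Moving the amount \<open>t\<close> from coordinate \<open>k\<close> to coordinate \<open>j\<close> keeps the sum. The largest
  admissible \<open>t\<close> brings one of the two to a bound, while all other coordinates stay where they are.
\<close>

lemma shift_to_bound:
  assumes fin: "finite I" and f: "f \<in> box_slice I lo hi d"
    and jk: "j \<in> slack I lo hi f" "k \<in> slack I lo hi f" "j \<noteq> k"
  obtains t where "t > 0" "f(j := f j + t, k := f k - t) \<in> box_slice I lo hi d"
    "card (slack I lo hi (f(j := f j + t, k := f k - t))) < card (slack I lo hi f)"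
proof
  define t where "t = min (hi j - f j) (f k - lo k)"
  let ?f = "f(j := f j + t, k := f k - t)"
  have t: "t \<le> hi j - f j" "t \<le> f k - lo k" "t = hi j - f j \<or> t = f k - lo k"
    by (auto simp: t_def)
  show "t > 0" using jk by (auto simp: t_def slack_def)
  have jkI: "j \<in> I" "k \<in> I" using jk by (auto simp: slack_def)
  have "(\<Sum>i\<in>I. ?f i) = (\<Sum>i\<in>I. f i + (if i = j then t else 0) - (if i = k then t else 0))"
    using jk by (intro sum.cong) auto
  also have "\<dots> = d"
    using f fin jkI by (simp add: sum.distrib sum_subtractf box_slice_def)
  finally have "(\<Sum>i\<in>I. ?f i) = d" .
  then show "?f \<in> box_slice I lo hi d"
    using f jk jkI t \<open>t > 0\<close> by (auto simp: box_slice_def slack_def)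
  show "card (slack I lo hi ?f) < card (slack I lo hi f)"
  proof (rule psubset_card_mono)
    show "finite (slack I lo hi f)" using fin by (simp add: slack_def)
    have "slack I lo hi ?f \<subseteq> slack I lo hi f"
      using jk by (auto simp: slack_def split: if_splits)
    moreover have "j \<notin> slack I lo hi ?f \<or> k \<notin> slack I lo hi ?f"
      using t(3) jk(3) by (auto simp: slack_def)
    ultimately show "slack I lo hi ?f \<subset> slack I lo hi f" using jk by blast
  qed
qed

text \<open>
  As long as two coordinates are slack, the point lies on the segment between the two points
  reached by shifting between these coordinates in either direction, and both ends have fewer
  slack coordinates.
\<close>

lemma box_slice_in_hull_of_tight_points:
  assumes fin: "finite I" and f: "f \<in> box_slice I lo hi d"
  shows "f \<in> convex hull {h \<in> box_slice I lo hi d. card (slack I lo hi h) \<le> 1}"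
  using f
proof (induction "card (slack I lo hi f)" arbitrary: f rule: less_induct)
  case less
  let ?C = "convex hull {h \<in> box_slice I lo hi d. card (slack I lo hi h) \<le> 1}"
  show ?case
  proof (cases "card (slack I lo hi f) \<le> 1")
    case True
    with less.prems show ?thesis by (simp add: hull_inc)
  next
    case False
    have fin_slack: "finite (slack I lo hi f)" using fin by (simp add: slack_def)
    with False obtain j k where jk: "j \<in> slack I lo hi f" "k \<in> slack I lo hi f" "j \<noteq> k"
      by (metis One_nat_def card_le_Suc0_iff_eq)
    have hull_after_shift: "\<exists>t>0. f(a := f a + t, b := f b - t) \<in> ?C"
      if "a \<in> slack I lo hi f" "b \<in> slack I lo hi f" "a \<noteq> b" for a b
      using shift_to_bound[OF fin less.prems that] less.hyps by blast
    obtain s where s: "s > 0" "f(j := f j + s, k := f k - s) \<in> ?C"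
      using hull_after_shift[OF jk] by blast
    obtain t where t: "t > 0" "f(k := f k + t, j := f j - t) \<in> ?C"
      using hull_after_shift[OF jk(2,1)] jk(3) by blast
    \<comment> \<open>The weights are inversely proportional to the shifts, so the two displacements cancel.\<close>
    define \<alpha> \<beta> where "\<alpha> = t / (s + t)" and "\<beta> = s / (s + t)"
    have ab: "\<alpha> \<ge> 0" "\<beta> \<ge> 0" "\<alpha> + \<beta> = 1" "\<alpha> * s = \<beta> * t"
      using s(1) t(1) by (simp_all add: \<alpha>_def \<beta>_def add_divide_distrib[symmetric])
    have "\<alpha> *\<^sub>R (f(j := f j + s, k := f k - s)) + \<beta> *\<^sub>R (f(k := f k + t, j := f j - t)) \<in> ?C"
      using s t ab by (intro convexD convex_convex_hull)
    moreover have "\<alpha> *\<^sub>R (f(j := f j + s, k := f k - s)) + \<beta> *\<^sub>R (f(k := f k + t, j := f j - t)) = f"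
    proof
      fix i
      have "\<alpha> * a + \<beta> * a = a" for a
        using ab(3) by (metis distrib_right mult_1)
      then show "(\<alpha> *\<^sub>R (f(j := f j + s, k := f k - s))
          + \<beta> *\<^sub>R (f(k := f k + t, j := f j - t))) i = f i"
        using jk(3) ab(4) by (simp add: distrib_left right_diff_distrib)
    qed
    ultimately show ?thesis by simp
  qed
qed

section \<open>The network of the flow set\<close>

abbreviation node_sum :: "node \<Rightarrow> real" where "node_sum v \<equiv> fst (snd v)"
abbreviation node_marks :: "node \<Rightarrow> nat set" where "node_marks v \<equiv> snd (snd v)"

definition layer_arcs ::
  "nat \<Rightarrow> (nat \<Rightarrow> real) \<Rightarrow> (nat \<Rightarrow> real) \<Rightarrow> real \<Rightarrow> nat \<Rightarrow> (node \<times> node) set" where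
  "layer_arcs n flo fhi d i = step_arcs n flo fhi d i (layers n flo fhi d i)"

text \<open>
  The value \<open>\<theta>\<close> of an arc is the difference of the partial sums at its ends, so membership can be
  decided without existential quantifiers.
\<close>

lemma mem_step_arcs_iff:
  "(u, v) \<in> step_arcs n flo fhi d i B \<longleftrightarrow>
     u \<in> B \<and> fst u = int i - 1 \<and> fst v = int i \<and>
     lower_partial n flo fhi d i \<le> node_sum v \<and> node_sum v \<le> upper_partial n flo fhi d i \<and>
     (node_sum v - node_sum u \<in> extreme_values flo fhi i \<and> node_marks v = node_marks u \<or>
      node_sum v - node_sum u \<in> balancing_values n flo fhi d i \<and> node_marks u = {} \<and> node_marks v = {i})"
  (is "_ \<longleftrightarrow> ?rhs")
proof
  show "(u, v) \<in> step_arcs n flo fhi d i B \<Longrightarrow> ?rhs"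
    by (auto simp: step_arcs_def)
  obtain i' \<delta> S i'' \<delta>' S' where uv: "u = (i', \<delta>, S)" "v = (i'', \<delta> + (\<delta>' - \<delta>), S')"
    by (cases u; cases v) auto
  show "?rhs \<Longrightarrow> (u, v) \<in> step_arcs n flo fhi d i B"
    unfolding step_arcs_def uv by (simp only: fst_conv snd_conv add_diff_cancel_left') blast
qed

text \<open>
  A balancing value depends on the remaining flows only, and each of these has at most three
  candidates.
\<close>

lemma finite_balancing_values: "finite (balancing_values n flo fhi d k)"
proof (rule finite_subset)
  let ?J = "{0..n} - {k}"
  show "balancing_values n flo fhi d k \<subseteq> (\<lambda>f. d - sum f ?J) ` PiE ?J (extreme_values flo fhi)"
  proof
    fix v assume "v \<in> balancing_values n flo fhi d k"
    then obtain f where "\<forall>j\<in>?J. f j \<in> extreme_values flo fhi j" "v = d - sum f ?J"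
      unfolding balancing_values_def by blast
    then show "v \<in> (\<lambda>f. d - sum f ?J) ` PiE ?J (extreme_values flo fhi)"
      by (intro image_eqI[of _ _ "restrict f ?J"]) auto
  qed
  show "finite ((\<lambda>f. d - sum f ?J) ` PiE ?J (extreme_values flo fhi))"
    by (intro finite_imageI finite_PiE) (auto simp: extreme_values_def)
qed

lemma finite_step_arcs:
  assumes "finite B"
  shows "finite (step_arcs n flo fhi d i B)"
proof (rule finite_subset)
  let ?T = "extreme_values flo fhi i \<union> balancing_values n flo fhi d i"
  let ?arc = "\<lambda>(u, \<theta>, S). (u, (int i, node_sum u + \<theta>, S))"
  show "step_arcs n flo fhi d i B \<subseteq> ?arc ` (B \<times> ?T \<times> (insert {i} (node_marks ` B)))"
  proof
    fix a assume a: "a \<in> step_arcs n flo fhi d i B"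
    obtain u v where uv: "a = (u, v)" by (cases a)
    have "v = (int i, node_sum u + (node_sum v - node_sum u), node_marks v)"
      using a by (cases v) (simp add: uv mem_step_arcs_iff)
    moreover have "u \<in> B" "node_sum v - node_sum u \<in> ?T" "node_marks v \<in> insert {i} (node_marks ` B)"
      using a unfolding uv mem_step_arcs_iff by auto
    ultimately show "a \<in> ?arc ` (B \<times> ?T \<times> (insert {i} (node_marks ` B)))"
      unfolding uv by (intro image_eqI[of _ _ "(u, node_sum v - node_sum u, node_marks v)"]) auto
  qed
  show "finite (?arc ` (B \<times> ?T \<times> (insert {i} (node_marks ` B))))"
    using assms
    by (intro finite_imageI finite_cartesian_product finite_UnI finite_insert[THEN iffD2]
        finite_balancing_values) (simp_all add: extreme_values_def)
qed

lemma finite_layers: "finite (layers n flo fhi d i)"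
  by (induction i) (simp_all add: finite_step_arcs)

lemma layers_index: "v \<in> layers n flo fhi d i \<Longrightarrow> fst v = int i - 1"
proof (cases i)
  case (Suc j)
  assume "v \<in> layers n flo fhi d i"
  with Suc obtain u where "(u, v) \<in> step_arcs n flo fhi d j (layers n flo fhi d j)" by auto
  with Suc show ?thesis by (simp add: mem_step_arcs_iff)
qed (simp add: source_def)

text \<open>
  The recursion \<open>layers\<close> continues beyond layer \<open>n\<close>, so the locale applies to it for all indices;
  its layer \<open>i\<close> is the layer with index \<open>i - 1\<close> of the network.
\<close>

interpretation layered_network "layers n flo fhi d" "layer_arcs n flo fhi d" source for n flo fhi d
proof
  show "layer_arcs n flo fhi d i \<subseteq> layers n flo fhi d i \<times> layers n flo fhi d (Suc i)" for i
  proof safe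
    fix u v assume "(u, v) \<in> layer_arcs n flo fhi d i"
    then have arc: "(u, v) \<in> step_arcs n flo fhi d i (layers n flo fhi d i)"
      by (simp add: layer_arcs_def)
    then show "u \<in> layers n flo fhi d i" by (simp add: mem_step_arcs_iff)
    show "v \<in> layers n flo fhi d (Suc i)" using image_eqI[OF _ arc, of v snd] by simp
  qed
  show "layers n flo fhi d i \<inter> layers n flo fhi d j = {}" if "i \<noteq> j" for i j
    using that layers_index[of _ n flo fhi d i] layers_index[of _ n flo fhi d j] by fastforce
qed (simp_all add: layer_arcs_def finite_step_arcs finite_layers)

definition idle_arc :: "node \<times> node \<Rightarrow> bool" where
  "idle_arc a \<longleftrightarrow> node_sum (snd a) = node_sum (fst a) \<and> node_marks (snd a) = node_marks (fst a)"

text \<open>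
  The case \<open>i = 0\<close> is excluded because \<open>x\<^sub>0\<close> is the constant 1 and no coordinate of \<open>x\<close>.
\<close>

definition arc_vector :: "nat \<Rightarrow> node \<times> node \<Rightarrow> (nat \<Rightarrow> real) \<times> (nat \<Rightarrow> real)" where
  "arc_vector i a = (if i = 0 \<or> idle_arc a then 0 else indicator {i},
                     (node_sum (snd a) - node_sum (fst a)) *\<^sub>R indicator {i})"

text \<open>
  The invariant of a path that has fixed the coordinates below \<open>i\<close> and arrived at the node \<open>v\<close>.
\<close>

definition partial_solutions ::
  "(nat \<Rightarrow> real) \<Rightarrow> (nat \<Rightarrow> real) \<Rightarrow> nat \<Rightarrow> node \<Rightarrow> ((nat \<Rightarrow> real) \<times> (nat \<Rightarrow> real)) set" where
  "partial_solutions flo fhi i v =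
     {(x, f). x \<in> vectors_on {1..<i} \<and> (\<forall>j\<in>{1..<i}. x j \<in> {0, 1}) \<and>
              f \<in> vectors_on {..<i} \<and> (\<Sum>j<i. f j) = node_sum v \<and>
              (\<forall>j<i. flo j * (x(0 := 1)) j \<le> f j \<and> f j \<le> fhi j * (x(0 := 1)) j)}"

lemma zero_partial_solution: "0 \<in> partial_solutions flo fhi 0 source"
  by (simp add: partial_solutions_def vectors_on_def source_def zero_prod_def)

lemma sum_fun_apply: "(\<Sum>i\<in>I. g i) j = (\<Sum>i\<in>I. g i j)"
  for g :: "'i \<Rightarrow> 'a \<Rightarrow> 'b::comm_monoid_add"
  by (induction I rule: infinite_finite_induct) simp_all

lemma sum_coordinates:
  fixes h :: "nat \<Rightarrow> real"
  assumes "h \<in> vectors_on {0..n}"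
  shows "(\<Sum>i<Suc n. h i *\<^sub>R indicator {i}) = h"
proof
  fix j
  have "(\<Sum>i<Suc n. h i *\<^sub>R (indicator {i} :: nat \<Rightarrow> real)) j = (\<Sum>i<Suc n. if i = j then h i else 0)"
    unfolding sum_fun_apply by (intro sum.cong) (auto simp: indicator_def)
  also have "\<dots> = h j"
    using assms by (auto simp: vectors_on_def simp del: sum.lessThan_Suc)
  finally show "(\<Sum>i<Suc n. h i *\<^sub>R (indicator {i} :: nat \<Rightarrow> real)) j = h j" .
qed

locale symmetric_flow_bounds =
  fixes n :: nat and flo fhi :: "nat \<Rightarrow> real"
  assumes fhi_pos: "\<forall>j\<in>{1..n}. fhi j > 0"
    and flo_eq: "\<forall>j\<in>{1..n}. flo j = - fhi j"
    and bounds_0: "flo 0 \<le> fhi 0"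
begin

lemma symmetric_bounds:
  assumes "1 \<le> j" "j \<le> n"
  shows "fhi j > 0" "flo j = - fhi j"
  using assms fhi_pos flo_eq by simp_all

lemma arc_flow_within_bounds:
  assumes "(u, v) \<in> layer_arcs n flo fhi d i" "i \<le> n"
  shows "flo i \<le> node_sum v - node_sum u" "node_sum v - node_sum u \<le> fhi i"
proof -
  have "flo i \<le> \<theta> \<and> \<theta> \<le> fhi i" if "\<theta> \<in> extreme_values flo fhi i" for \<theta>
  proof (cases "i = 0")
    case True
    then show ?thesis using that bounds_0 by (auto simp: extreme_values_def)
  next
    case False
    then show ?thesis
      using that symmetric_bounds[of i] assms(2) by (auto simp: extreme_values_def)
  qed
  moreover have "flo i \<le> \<theta> \<and> \<theta> \<le> fhi i" if "\<theta> \<in> balancing_values n flo fhi d i" for \<theta>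
    using that unfolding balancing_values_def by blast
  ultimately have "flo i \<le> node_sum v - node_sum u \<and> node_sum v - node_sum u \<le> fhi i"
    using assms(1) unfolding layer_arcs_def mem_step_arcs_iff by metis
  then show "flo i \<le> node_sum v - node_sum u" "node_sum v - node_sum u \<le> fhi i"
    by blast+
qed

text \<open>
  Extreme and balancing values respect the bounds of coordinate \<open>i\<close>, and \<open>x\<^sub>i = 0\<close> is chosen only
  on idle arcs, whose flow is 0.
\<close>

lemma partial_solutions_extend:
  assumes arc: "(u, v) \<in> layer_arcs n flo fhi d i" and "i \<le> n"
    and z: "z \<in> partial_solutions flo fhi i u"
  shows "z + arc_vector i (u, v) \<in> partial_solutions flo fhi (Suc i) v"
proof -
  obtain x f where zxf: "z = (x, f)" by (cases z)
  let ?\<theta> = "node_sum v - node_sum u"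
  let ?b = "if i = 0 \<or> idle_arc (u, v) then 0 else 1 :: real"
  have x_i: "x i = 0" and f_i: "f i = 0"
    using z by (auto simp: zxf partial_solutions_def vectors_on_def)
  have sum: "z + arc_vector i (u, v) = (x(i := ?b), f(i := ?\<theta>))"
    using x_i f_i by (auto simp: zxf arc_vector_def fun_eq_iff indicator_def)
  have sum_f: "(\<Sum>j<Suc i. (f(i := ?\<theta>)) j) = node_sum v"
    using z by (simp add: zxf partial_solutions_def)
  have bounds: "flo j * ((x(i := ?b))(0 := 1)) j \<le> (f(i := ?\<theta>)) j \<and>
      (f(i := ?\<theta>)) j \<le> fhi j * ((x(i := ?b))(0 := 1)) j" if "j < Suc i" for j
  proof (cases "j = i")
    case True
    have "idle_arc (u, v) \<Longrightarrow> ?\<theta> = 0" by (simp add: idle_arc_def)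
    with True show ?thesis
      using arc_flow_within_bounds[OF arc \<open>i \<le> n\<close>] by (cases "i = 0") auto
  next
    case False
    with that have "j < i" by simp
    then have "flo j * (x(0 := 1)) j \<le> f j \<and> f j \<le> fhi j * (x(0 := 1)) j"
      using z unfolding zxf partial_solutions_def by blast
    with False show ?thesis by auto
  qed
  have "x(i := ?b) \<in> vectors_on {1..<Suc i}" "f(i := ?\<theta>) \<in> vectors_on {..<Suc i}"
    using z by (auto simp: zxf partial_solutions_def vectors_on_def)
  moreover have "\<forall>j\<in>{1..<Suc i}. (x(i := ?b)) j \<in> {0, 1}"
  proof
    fix j assume "j \<in> {1..<Suc i}"
    then consider "j = i" | "j \<in> {1..<i}" by fastforce
    then show "(x(i := ?b)) j \<in> {0, 1}"
    proof cases
      case 2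
      then have "x j \<in> {0, 1}" using z unfolding zxf partial_solutions_def by blast
      with 2 show ?thesis by simp
    qed simp
  qed
  ultimately show ?thesis
    using bounds sum_f unfolding sum partial_solutions_def by blast
qed

text \<open>
  In layer \<open>n\<close> the outer sums are empty, so the lower bound on partial sums is at least \<open>d\<close> and
  the upper bound is at most \<open>d\<close>.
\<close>

lemma partial_solutions_last_layer:
  assumes "v \<in> layers n flo fhi d (Suc n)"
  shows "partial_solutions flo fhi (Suc n) v \<subseteq> flow_set n flo fhi d"
proof -
  obtain u where "(u, v) \<in> layer_arcs n flo fhi d n"
    using assms by (auto simp: layer_arcs_def)
  then have "node_sum v = d"
    by (simp add: layer_arcs_def mem_step_arcs_iff lower_partial_def upper_partial_def)
  moreover have "{1..<Suc n} = {1..n}" "{..<Suc n} = {0..n}" by auto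
  ultimately show ?thesis
    by (auto simp: partial_solutions_def flow_set_def)
qed

text \<open>
  The construction never discards the partial sums of a feasible flow: the first \<open>i + 1\<close> flows are
  bounded directly, and also as \<open>d\<close> minus the remaining ones.
\<close>

lemma partial_sum_within_bounds:
  assumes sum: "(\<Sum>j=0..n. f j) = d" and bounds: "\<And>j. j \<le> n \<Longrightarrow> flo j \<le> f j \<and> f j \<le> fhi j"
    and "i \<le> n"
  shows "lower_partial n flo fhi d i \<le> (\<Sum>j<Suc i. f j)"
    "(\<Sum>j<Suc i. f j) \<le> upper_partial n flo fhi d i"
proof -
  have split: "(\<Sum>j<Suc i. f j) = d - (\<Sum>j=i+1..n. f j)"
  proof -
    have "{0..n} = {..<Suc i} \<union> {i+1..n}" using \<open>i \<le> n\<close> by auto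
    then have "(\<Sum>j=0..n. f j) = (\<Sum>j<Suc i. f j) + (\<Sum>j=i+1..n. f j)"
      by (simp only:) (rule sum.union_disjoint; auto)
    then show ?thesis using sum by simp
  qed
  have "{..<Suc i} = {0..i}" by auto
  then have "(\<Sum>j=0..i. flo j) \<le> (\<Sum>j<Suc i. f j)" "(\<Sum>j<Suc i. f j) \<le> (\<Sum>j=0..i. fhi j)"
    using bounds \<open>i \<le> n\<close> by (auto intro!: sum_mono simp del: sum.lessThan_Suc)
  moreover have "(\<Sum>j=i+1..n. flo j) \<le> (\<Sum>j=i+1..n. f j)" "(\<Sum>j=i+1..n. f j) \<le> (\<Sum>j=i+1..n. fhi j)"
    using bounds by (auto intro!: sum_mono)
  ultimately show "lower_partial n flo fhi d i \<le> (\<Sum>j<Suc i. f j)"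
    "(\<Sum>j<Suc i. f j) \<le> upper_partial n flo fhi d i"
    using split by (simp_all add: lower_partial_def upper_partial_def)
qed

lemma flow_set_bounds:
  assumes "(x, f) \<in> flow_set n flo fhi d" "j \<le> n"
  shows "flo j * (x(0 := 1)) j \<le> f j \<and> f j \<le> fhi j * (x(0 := 1)) j"
    and "flo j \<le> f j \<and> f j \<le> fhi j"
proof -
  show xf: "flo j * (x(0 := 1)) j \<le> f j \<and> f j \<le> fhi j * (x(0 := 1)) j"
    using assms unfolding flow_set_def by force
  have "x j = 0 \<or> x j = 1" if "j \<noteq> 0"
    using that assms unfolding flow_set_def by force
  then show "flo j \<le> f j \<and> f j \<le> fhi j"
    using xf symmetric_bounds[of j] \<open>j \<le> n\<close> by (cases "j = 0") auto
qed

text \<open>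
  The index \<open>k\<close> is the only slack coordinate, or \<open>n + 1\<close> if there is none. A slack coordinate
  \<open>k \<ge> 1\<close> has \<open>x\<^sub>k = 1\<close>, as both bounds are 0 otherwise. It may carry zero flow, and the mark
  tells this apart from \<open>x\<^sub>k = 0\<close>. For the other coordinates \<open>x\<^sub>j = 1\<close> puts the flow at
  \<open>\<plusminus>fhi j \<noteq> 0\<close>, so the flow alone determines \<open>x\<^sub>j\<close>.
\<close>

lemma tight_solution_values:
  assumes xf: "(x, f) \<in> flow_set n flo fhi d"
    and tight: "card (slack {0..n} (\<lambda>j. flo j * (x(0 := 1)) j) (\<lambda>j. fhi j * (x(0 := 1)) j) f) \<le> 1"
  shows "\<exists>k. (\<forall>j\<le>n. j \<noteq> k \<longrightarrow> f j \<in> extreme_values flo fhi j) \<and>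
    (\<forall>j\<in>{1..n}. x j = 0 \<longleftrightarrow> f j = 0 \<and> j \<noteq> k)"
proof -
  define N where "N = slack {0..n} (\<lambda>j. flo j * (x(0 := 1)) j) (\<lambda>j. fhi j * (x(0 := 1)) j) f"
  have x: "x j = 0 \<or> x j = 1" if "1 \<le> j" "j \<le> n" for j
    using that xf unfolding flow_set_def by auto
  have mem_N: "j \<in> N \<longleftrightarrow> f j \<noteq> flo j * (x(0 := 1)) j \<and> f j \<noteq> fhi j * (x(0 := 1)) j"
    if "j \<le> n" for j
    using flow_set_bounds(1)[OF xf that] that by (auto simp: N_def slack_def)
  have "finite N" "N \<subseteq> {0..n}" by (auto simp: N_def slack_def)
  moreover have "card N \<le> Suc 0" using tight by (simp add: N_def)
  ultimately have N_unique: "j = k" if "j \<in> N" "k \<in> N" for j k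
    using that card_le_Suc0_iff_eq[of N] by blast
  obtain k where k: "N \<subseteq> {k}" "k \<le> n \<Longrightarrow> k \<in> N"
  proof (cases "N = {}")
    case True
    then show ?thesis using that[of "Suc n"] by simp
  next
    case False
    then obtain k where "k \<in> N" by blast
    then show ?thesis using that[of k] N_unique by blast
  qed
  have at_bound: "f j = flo j * (x(0 := 1)) j \<or> f j = fhi j * (x(0 := 1)) j"
    if "j \<le> n" "j \<noteq> k" for j
    using mem_N[OF that(1)] that(2) k(1) by blast
  show ?thesis
  proof (intro exI[of _ k] conjI allI impI ballI)
    show "f j \<in> extreme_values flo fhi j" if "j \<le> n" "j \<noteq> k" for j
      using at_bound[OF that] x[of j] symmetric_bounds[of j] \<open>j \<le> n\<close>
      by (cases "j = 0") (auto simp: extreme_values_def)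
    show "x j = 0 \<longleftrightarrow> f j = 0 \<and> j \<noteq> k" if "j \<in> {1..n}" for j
    proof (cases "j = k")
      case True
      then have "j \<in> N" using k(2) that by simp
      then have "x j \<noteq> 0"
        using mem_N[of j] flow_set_bounds(1)[OF xf, of j] that by auto
      with True show ?thesis by simp
    next
      case False
      then show ?thesis
        using at_bound[of j] x[of j] symmetric_bounds[of j] that by auto
    qed
  qed
qed

lemma tight_solution_is_flow_vector:
  assumes xf: "(x, f) \<in> flow_set n flo fhi d"
    and tight: "card (slack {0..n} (\<lambda>j. flo j * (x(0 := 1)) j) (\<lambda>j. fhi j * (x(0 := 1)) j) f) \<le> 1"
  shows "(x, f) \<in> flow_vector n flo fhi d arc_vector (Suc n) ` {Y. unit_flow n flo fhi d (Suc n) Y}"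
proof -
  obtain k where k: "\<forall>j\<le>n. j \<noteq> k \<longrightarrow> f j \<in> extreme_values flo fhi j"
      "\<forall>j\<in>{1..n}. x j = 0 \<longleftrightarrow> f j = 0 \<and> j \<noteq> k"
    using tight_solution_values[OF xf tight] by blast
  have extreme: "f j \<in> extreme_values flo fhi j" if "j \<le> n" "j \<noteq> k" for j
    using k(1) that by blast
  have x_eq_0: "x j = 0 \<longleftrightarrow> f j = 0 \<and> j \<noteq> k" if "1 \<le> j" "j \<le> n" for j
    using k(2) that by simp
  have x: "x \<in> vectors_on {0..n}" "x 0 = 0" and f: "f \<in> vectors_on {0..n}"
    and sum_f: "(\<Sum>j=0..n. f j) = d"
    using xf by (auto simp: flow_set_def vectors_on_def)
  have x_eq_1: "x j = 1" if "1 \<le> j" "j \<le> n" "x j \<noteq> 0" for j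
    using that xf by (auto simp: flow_set_def)
  \<comment> \<open>The path follows the partial sums of \<open>f\<close> and sets the mark when it passes coordinate \<open>k\<close>.\<close>
  define \<nu> :: "nat \<Rightarrow> node" where
    "\<nu> i = (int i - 1, (\<Sum>j<i. f j), if k < i then {k} else {})" for i
  have \<nu>_step: "node_sum (\<nu> (Suc i)) - node_sum (\<nu> i) = f i" for i
    by (simp add: \<nu>_def)
  have \<nu>_marks: "node_marks (\<nu> (Suc i)) = (if i = k then {i} else node_marks (\<nu> i))" for i
    by (simp add: \<nu>_def less_Suc_eq)
  have arc: "(\<nu> i, \<nu> (Suc i)) \<in> layer_arcs n flo fhi d i"
    if \<nu>_i: "\<nu> i \<in> layers n flo fhi d i" and "i \<le> n" for i
  proof -
    have "f i \<in> balancing_values n flo fhi d i" if "i = k"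
    proof -
      have "f i = d - sum f ({0..n} - {i})"
        using sum_f sum.remove[of "{0..n}" i f] \<open>i \<le> n\<close> by simp
      moreover have "\<forall>j\<in>{0..n} - {i}. f j \<in> extreme_values flo fhi j"
        using extreme that by simp
      ultimately show ?thesis
        using flow_set_bounds(2)[OF xf \<open>i \<le> n\<close>] unfolding balancing_values_def by blast
    qed
    moreover have "node_marks (\<nu> k) = {}" by (simp add: \<nu>_def)
    moreover have "lower_partial n flo fhi d i \<le> node_sum (\<nu> (Suc i))"
      "node_sum (\<nu> (Suc i)) \<le> upper_partial n flo fhi d i"
      using partial_sum_within_bounds[OF sum_f flow_set_bounds(2)[OF xf] \<open>i \<le> n\<close>]
      unfolding \<nu>_def by auto
    moreover have "fst (\<nu> i) = int i - 1" "fst (\<nu> (Suc i)) = int i" by (simp_all add: \<nu>_def)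
    ultimately show ?thesis
      using \<nu>_i extreme[OF \<open>i \<le> n\<close>] unfolding layer_arcs_def mem_step_arcs_iff \<nu>_step \<nu>_marks
      by (cases "i = k") simp_all
  qed
  have "\<nu> i \<in> layers n flo fhi d i" if "i \<le> Suc n" for i
    using that
  proof (induction i)
    case 0
    then show ?case by (simp add: \<nu>_def source_def)
  next
    case (Suc i)
    then have "(\<nu> i, \<nu> (Suc i)) \<in> layer_arcs n flo fhi d i" using arc by simp
    then have "snd (\<nu> i, \<nu> (Suc i)) \<in> layers n flo fhi d (Suc i)"
      unfolding L_Suc by (rule imageI)
    then show ?case by simp
  qed
  with arc have path: "(\<nu> i, \<nu> (Suc i)) \<in> layer_arcs n flo fhi d i" if "i < Suc n" for i
    using that by simp
  have arc_vector: "arc_vector i (\<nu> i, \<nu> (Suc i)) = (x i *\<^sub>R indicator {i}, f i *\<^sub>R indicator {i})"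
    if "i \<le> n" for i
  proof -
    have "node_marks (\<nu> k) = {}" by (simp add: \<nu>_def)
    then have "idle_arc (\<nu> i, \<nu> (Suc i)) \<longleftrightarrow> f i = 0 \<and> i \<noteq> k"
      using \<nu>_step[of i] by (auto simp: idle_arc_def \<nu>_marks)
    then have "(if i = 0 \<or> idle_arc (\<nu> i, \<nu> (Suc i)) then 0 else indicator {i} :: nat \<Rightarrow> real)
        = x i *\<^sub>R indicator {i}"
      using x(2) x_eq_0[of i] x_eq_1[of i] \<open>i \<le> n\<close> by (cases "i = 0") auto
    then show ?thesis
      using \<nu>_step[of i] unfolding arc_vector_def by simp
  qed
  have "(\<Sum>i<Suc n. arc_vector i (\<nu> i, \<nu> (Suc i)))
      = (\<Sum>i<Suc n. (x i *\<^sub>R indicator {i}, f i *\<^sub>R indicator {i}))"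
    by (intro sum.cong refl arc_vector) simp
  also have "\<dots> = (\<Sum>i<Suc n. x i *\<^sub>R indicator {i}, \<Sum>i<Suc n. f i *\<^sub>R indicator {i})"
    by (rule sum_prod)
  also have "\<dots> = (x, f)"
    unfolding sum_coordinates[OF x(1)] sum_coordinates[OF f] ..
  finally have "(\<Sum>i<Suc n. arc_vector i (\<nu> i, \<nu> (Suc i))) = (x, f)" .
  moreover have "(\<Sum>i<Suc n. arc_vector i (\<nu> i, \<nu> (Suc i)))
      \<in> flow_vector n flo fhi d arc_vector (Suc n) ` {Y. unit_flow n flo fhi d (Suc n) Y}"
    by (rule path_is_unit_flow[where g = arc_vector]) (rule path, assumption, rule zero_less_Suc)
  ultimately show ?thesis by (simp only:)
qed

lemma flow_set_subset_hull_of_tight_solutions: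
  "flow_set n flo fhi d \<subseteq> convex hull {(x, f) \<in> flow_set n flo fhi d.
     card (slack {0..n} (\<lambda>j. flo j * (x(0 := 1)) j) (\<lambda>j. fhi j * (x(0 := 1)) j) f) \<le> 1}"
  (is "_ \<subseteq> convex hull ?V")
proof (rule subrelI)
  fix x f assume xf: "(x, f) \<in> flow_set n flo fhi d"
  let ?lo = "\<lambda>j. flo j * (x(0 := 1)) j" and ?hi = "\<lambda>j. fhi j * (x(0 := 1)) j"
  let ?T = "{h \<in> box_slice {0..n} ?lo ?hi d. card (slack {0..n} ?lo ?hi h) \<le> 1}"
  have slice: "(x, h) \<in> flow_set n flo fhi d \<longleftrightarrow> h \<in> box_slice {0..n} ?lo ?hi d" for h
    using xf by (auto simp: flow_set_def box_slice_def vectors_on_def)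
  have "f \<in> convex hull ?T"
    using box_slice_in_hull_of_tight_points[of "{0..n}" f ?lo ?hi d] xf slice by simp
  then have "(x, f) \<in> convex hull ({x} \<times> ?T)"
    by (simp add: convex_hull_Times)
  moreover have "{x} \<times> ?T \<subseteq> ?V" using slice by auto
  ultimately show "(x, f) \<in> convex hull ?V" using hull_mono by blast
qed

theorem convex_hull_flow_set:
  "convex hull flow_set n flo fhi d =
     flow_vector n flo fhi d arc_vector (Suc n) ` {Y. unit_flow n flo fhi d (Suc n) Y}" (is "_ = ?R")
proof
  have "convex hull {(x, f) \<in> flow_set n flo fhi d.
      card (slack {0..n} (\<lambda>j. flo j * (x(0 := 1)) j) (\<lambda>j. fhi j * (x(0 := 1)) j) f) \<le> 1} \<subseteq> ?R"
    using tight_solution_is_flow_vector by (intro hull_minimal convex_flow_vectors) auto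
  then show "convex hull flow_set n flo fhi d \<subseteq> ?R"
    using flow_set_subset_hull_of_tight_solutions[of d] convex_flow_vectors
    by (intro hull_minimal) auto
  show "?R \<subseteq> convex hull flow_set n flo fhi d"
  proof (rule image_subsetI)
    fix Y assume "Y \<in> {Y. unit_flow n flo fhi d (Suc n) Y}"
    then have "unit_flow n flo fhi d (Suc n) Y" by simp
    then have "flow_vector n flo fhi d arc_vector (Suc n) Y
        \<in> convex hull (\<Union>v\<in>layers n flo fhi d (Suc n). partial_solutions flo fhi (Suc n) v)"
      by (rule flow_vector_in_convex_hull[where P = "partial_solutions flo fhi",
            OF _ zero_partial_solution partial_solutions_extend])
    moreover have "(\<Union>v\<in>layers n flo fhi d (Suc n). partial_solutions flo fhi (Suc n) v)
        \<subseteq> flow_set n flo fhi d"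
      using partial_solutions_last_layer by blast
    ultimately show "flow_vector n flo fhi d arc_vector (Suc n) Y \<in> convex hull flow_set n flo fhi d"
      using hull_mono by blast
  qed
qed

end

section \<open>Coordinates of flow vectors\<close>

lemma fst_flow_vector:
  "fst (flow_vector n flo fhi d arc_vector M Y) j =
     (if 1 \<le> j \<and> j < M then \<Sum>a | a \<in> layer_arcs n flo fhi d j \<and> \<not> idle_arc a. Y a else 0)"
proof -
  let ?E = "layer_arcs n flo fhi d"
  have layer: "(\<Sum>a\<in>?E i. Y a * fst (arc_vector i a) j)
      = (if i = j then if 1 \<le> j then \<Sum>a | a \<in> ?E j \<and> \<not> idle_arc a. Y a else 0 else 0)" for i
  proof -
    have "(\<Sum>a\<in>?E j. Y a * fst (arc_vector j a) j) = (\<Sum>a\<in>?E j. if \<not> idle_arc a then Y a else 0)"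
      if "1 \<le> j"
      using that by (intro sum.cong) (auto simp: arc_vector_def)
    then show ?thesis
      by (auto simp: sum.If_cases finite_E Int_def arc_vector_def indicator_def intro!: sum.neutral)
  qed
  have "fst (flow_vector n flo fhi d arc_vector M Y) j = (\<Sum>i<M. \<Sum>a\<in>?E i. Y a * fst (arc_vector i a) j)"
    by (simp add: flow_vector_def fst_sum sum_fun_apply)
  then show ?thesis by (simp add: layer)
qed

lemma snd_flow_vector:
  "snd (flow_vector n flo fhi d arc_vector M Y) j =
     (if j < M then \<Sum>a\<in>layer_arcs n flo fhi d j. (node_sum (snd a) - node_sum (fst a)) * Y a else 0)"
proof -
  let ?E = "layer_arcs n flo fhi d"
  have layer: "(\<Sum>a\<in>?E i. Y a * snd (arc_vector i a) j)
      = (if i = j then \<Sum>a\<in>?E j. (node_sum (snd a) - node_sum (fst a)) * Y a else 0)" for i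
    by (auto simp: arc_vector_def indicator_def mult.commute intro!: sum.cong sum.neutral)
  have "snd (flow_vector n flo fhi d arc_vector M Y) j = (\<Sum>i<M. \<Sum>a\<in>?E i. Y a * snd (arc_vector i a) j)"
    by (simp add: flow_vector_def snd_sum sum_fun_apply)
  then show ?thesis by (simp add: layer)
qed

text \<open>
  The arcs of a layer carry one unit in total, which splits into idle and busy arcs.
\<close>

lemma idle_and_busy_flow:
  assumes "unit_flow n flo fhi d (Suc n) Y" "i \<le> n"
  shows "(\<Sum>a | a \<in> layer_arcs n flo fhi d i \<and> \<not> idle_arc a. Y a)
    = 1 - (\<Sum>a | a \<in> layer_arcs n flo fhi d i \<and> idle_arc a. Y a)" (is "?busy = 1 - ?idle")
    and "0 \<le> (\<Sum>a | a \<in> layer_arcs n flo fhi d i \<and> idle_arc a. Y a)"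
    and "0 \<le> (\<Sum>a | a \<in> layer_arcs n flo fhi d i \<and> \<not> idle_arc a. Y a)"
proof -
  let ?E = "layer_arcs n flo fhi d i"
  have "?idle + ?busy = (\<Sum>a\<in>{a. a \<in> ?E \<and> idle_arc a} \<union> {a. a \<in> ?E \<and> \<not> idle_arc a}. Y a)"
    by (rule sum.union_disjoint[symmetric]) (auto simp: finite_E)
  also have "{a. a \<in> ?E \<and> idle_arc a} \<union> {a. a \<in> ?E \<and> \<not> idle_arc a} = ?E" by blast
  finally show "?busy = 1 - ?idle"
    using unit_flow_layer_total[OF assms(1), of i] assms(2) by simp
  have "Y a \<ge> 0" if "a \<in> ?E" for a
    using assms that by (auto simp: unit_flow_def less_Suc_eq_le)
  then show "0 \<le> ?idle" "0 \<le> ?busy" by (auto intro: sum_nonneg)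
qed

text \<open>
  The coordinate \<open>x\<^sub>i\<close> of the flow vector is the flow on the busy arcs of layer \<open>i\<close>, which the formulation
  expresses as 1 minus the flow on the idle arcs.
\<close>

lemma eq_flow_vector_iff:
  assumes Y: "unit_flow n flo fhi d (Suc n) Y"
  shows "(x, f) = flow_vector n flo fhi d arc_vector (Suc n) Y \<longleftrightarrow>
    x \<in> vectors_on {1..n} \<and> f \<in> vectors_on {0..n} \<and>
    (\<forall>i\<in>{1..n}. x i = 1 - (\<Sum>a | a \<in> layer_arcs n flo fhi d i \<and> idle_arc a. Y a)) \<and>
    (\<forall>i\<in>{0..n}. f i = (\<Sum>a\<in>layer_arcs n flo fhi d i. (node_sum (snd a) - node_sum (fst a)) * Y a))"
proof -
  let ?v = "flow_vector n flo fhi d arc_vector (Suc n) Y"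
  let ?X = "\<lambda>i. 1 - (\<Sum>a | a \<in> layer_arcs n flo fhi d i \<and> idle_arc a. Y a)"
  let ?F = "\<lambda>i. \<Sum>a\<in>layer_arcs n flo fhi d i. (node_sum (snd a) - node_sum (fst a)) * Y a"
  have fst_v: "fst ?v j = (if j \<in> {1..n} then ?X j else 0)" for j
    using idle_and_busy_flow(1)[OF Y, of j] by (simp add: fst_flow_vector less_Suc_eq_le)
  have snd_v: "snd ?v j = (if j \<in> {0..n} then ?F j else 0)" for j
    by (simp add: snd_flow_vector less_Suc_eq_le)
  have on_support: "(\<forall>j. h j = (if j \<in> I then g j else 0)) \<longleftrightarrow> h \<in> vectors_on I \<and> (\<forall>j\<in>I. h j = g j)"
    for h g :: "nat \<Rightarrow> real" and I
    by (auto simp: vectors_on_def)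
  have "(x, f) = ?v \<longleftrightarrow> (\<forall>j. x j = fst ?v j) \<and> (\<forall>j. f j = snd ?v j)"
    by (simp add: prod_eq_iff fun_eq_iff)
  also have "\<dots> \<longleftrightarrow> (x \<in> vectors_on {1..n} \<and> (\<forall>j\<in>{1..n}. x j = ?X j)) \<and>
      (f \<in> vectors_on {0..n} \<and> (\<forall>j\<in>{0..n}. f j = ?F j))"
    unfolding fst_v snd_v on_support ..
  finally show ?thesis by blast
qed

section \<open>The constraints of the extended formulation\<close>

lemma layer_of_nat: "i \<le> n \<Longrightarrow> layer n flo fhi d (int i) = layers n flo fhi d (Suc i)"
  by (simp add: layer_def nat_add_distrib)

lemma layer_of_nat_minus_1: "i \<le> Suc n \<Longrightarrow> layer n flo fhi d (int i - 1) = layers n flo fhi d i"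
  by (simp add: layer_def)

lemma network_arcs_eq: "network_arcs n flo fhi d = (\<Union>i\<in>{0..n}. layer_arcs n flo fhi d i)"
  by (simp add: network_arcs_def layer_arcs_def layer_of_nat_minus_1)

text \<open>
  A node determines its layer by its first component, so an arc of the network touching a layer
  was created in the corresponding step.
\<close>

lemma network_arcs_at_layer:
  assumes "i \<le> n" "u \<in> layers n flo fhi d i \<or> v \<in> layers n flo fhi d (Suc i)"
  shows "(u, v) \<in> network_arcs n flo fhi d \<longleftrightarrow> (u, v) \<in> layer_arcs n flo fhi d i"
proof
  assume "(u, v) \<in> network_arcs n flo fhi d"
  then obtain j where j: "(u, v) \<in> layer_arcs n flo fhi d j" by (auto simp: network_arcs_eq)
  then have "u \<in> layers n flo fhi d j" "v \<in> layers n flo fhi d (Suc j)" using E_sub by blast+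
  then have "fst u = int j - 1" "fst v = int (Suc j) - 1"
    using layers_index by blast+
  moreover have "fst u = int i - 1 \<or> fst v = int (Suc i) - 1"
    using assms(2) layers_index by blast
  ultimately have "i = j" by auto
  with j show "(u, v) \<in> layer_arcs n flo fhi d i" by simp
next
  assume "(u, v) \<in> layer_arcs n flo fhi d i"
  with \<open>i \<le> n\<close> show "(u, v) \<in> network_arcs n flo fhi d" by (auto simp: network_arcs_eq)
qed

lemma inflow_eq:
  assumes "i \<le> n" "v \<in> layers n flo fhi d (Suc i)"
  shows "(\<Sum>u | u \<in> layers n flo fhi d i \<and> (u, v) \<in> network_arcs n flo fhi d. Y (u, v))
    = (\<Sum>a | a \<in> layer_arcs n flo fhi d i \<and> snd a = v. Y a)"
  using E_sub[of n flo fhi d i] network_arcs_at_layer[OF assms(1) disjI2[OF assms(2)]]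
  by (intro sum.reindex_bij_witness[of _ fst "\<lambda>u. (u, v)"]) auto

lemma outflow_eq:
  assumes "i \<le> n" "u \<in> layers n flo fhi d i"
  shows "(\<Sum>v | v \<in> layers n flo fhi d (Suc i) \<and> (u, v) \<in> network_arcs n flo fhi d. Y (u, v))
    = (\<Sum>a | a \<in> layer_arcs n flo fhi d i \<and> fst a = u. Y a)"
  using E_sub[of n flo fhi d i] network_arcs_at_layer[OF assms(1) disjI1[OF assms(2)]]
  by (intro sum.reindex_bij_witness[of _ snd "\<lambda>v. (u, v)"]) auto

lemma unit_flow_iff_network_constraints:
  fixes n flo fhi d
  defines "K \<equiv> layer n flo fhi d" and "A \<equiv> network_arcs n flo fhi d"
  shows "unit_flow n flo fhi d (Suc n) Y \<longleftrightarrow>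
    (\<forall>a\<in>A. Y a \<ge> 0) \<and>
    (\<Sum>\<eta> | \<eta> \<in> K 0 \<and> (source, \<eta>) \<in> A. Y (source, \<eta>)) = 1 \<and>
    (\<forall>i<n. \<forall>\<eta>'\<in>K (int i).
      (\<Sum>\<eta> | \<eta> \<in> K (int i - 1) \<and> (\<eta>, \<eta>') \<in> A. Y (\<eta>, \<eta>')) =
      (\<Sum>\<eta>'' | \<eta>'' \<in> K (int i + 1) \<and> (\<eta>', \<eta>'') \<in> A. Y (\<eta>', \<eta>'')))"
proof -
  have nonneg: "(\<forall>a\<in>A. Y a \<ge> 0) \<longleftrightarrow> (\<forall>i<Suc n. \<forall>a\<in>layer_arcs n flo fhi d i. Y a \<ge> 0)"
    by (auto simp: A_def network_arcs_eq less_Suc_eq_le)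
  have "{a. a \<in> layer_arcs n flo fhi d 0 \<and> fst a = source} = layer_arcs n flo fhi d 0"
    using E_sub[of n flo fhi d 0] by auto
  then have start: "(\<Sum>\<eta> | \<eta> \<in> K 0 \<and> (source, \<eta>) \<in> A. Y (source, \<eta>)) = (\<Sum>a\<in>layer_arcs n flo fhi d 0. Y a)"
    using outflow_eq[of 0 n source flo fhi d Y] layer_of_nat[of 0 n flo fhi d]
    by (simp add: K_def A_def)
  have conservation: "(\<Sum>\<eta> | \<eta> \<in> K (int i - 1) \<and> (\<eta>, \<eta>') \<in> A. Y (\<eta>, \<eta>')) =
        (\<Sum>a | a \<in> layer_arcs n flo fhi d i \<and> snd a = \<eta>'. Y a)"
      "(\<Sum>\<eta>'' | \<eta>'' \<in> K (int i + 1) \<and> (\<eta>', \<eta>'') \<in> A. Y (\<eta>', \<eta>'')) =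
        (\<Sum>a | a \<in> layer_arcs n flo fhi d (Suc i) \<and> fst a = \<eta>'. Y a)"
    if "i < n" "\<eta>' \<in> layers n flo fhi d (Suc i)" for i \<eta>'
  proof -
    have "K (int i - 1) = layers n flo fhi d i" "K (int i + 1) = layers n flo fhi d (Suc (Suc i))"
      using that layer_of_nat_minus_1[of i n] layer_of_nat[of "Suc i" n]
      by (simp_all add: K_def add.commute del: layers.simps)
    then show "(\<Sum>\<eta> | \<eta> \<in> K (int i - 1) \<and> (\<eta>, \<eta>') \<in> A. Y (\<eta>, \<eta>')) =
        (\<Sum>a | a \<in> layer_arcs n flo fhi d i \<and> snd a = \<eta>'. Y a)"
      "(\<Sum>\<eta>'' | \<eta>'' \<in> K (int i + 1) \<and> (\<eta>', \<eta>'') \<in> A. Y (\<eta>', \<eta>'')) =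
        (\<Sum>a | a \<in> layer_arcs n flo fhi d (Suc i) \<and> fst a = \<eta>'. Y a)"
      using inflow_eq[of i n \<eta>' flo fhi d Y] outflow_eq[of "Suc i" n \<eta>' flo fhi d Y] that
      by (simp_all add: A_def del: layers.simps)
  qed
  have K_nat: "K (int i) = layers n flo fhi d (Suc i)" if "i < n" for i
    using that by (simp add: K_def layer_of_nat del: layers.simps)
  show ?thesis
    unfolding unit_flow_def nonneg start Suc_less_eq by (simp add: K_nat conservation del: layers.simps)
qed

lemma idle_sum_eq:
  fixes n flo fhi d
  defines "K \<equiv> layer n flo fhi d" and "A \<equiv> network_arcs n flo fhi d"
  assumes "i \<le> n"
  shows "(\<Sum>(\<eta>, \<eta>') | (\<eta>, \<eta>') \<in> A \<and> \<eta> \<in> K (int i - 1) \<and> \<eta>' \<in> K (int i) \<and>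
                (\<exists>\<delta> S. \<eta> = (int i - 1, \<delta>, S) \<and> \<eta>' = (int i, \<delta>, S)). Y (\<eta>, \<eta>'))
    = (\<Sum>a | a \<in> layer_arcs n flo fhi d i \<and> idle_arc a. Y a)"
proof -
  have K: "K (int i - 1) = layers n flo fhi d i" "K (int i) = layers n flo fhi d (Suc i)"
    using \<open>i \<le> n\<close> layer_of_nat_minus_1[of i n] layer_of_nat[of i n] unfolding K_def by simp_all
  have "(\<eta>, \<eta>') \<in> A \<and> \<eta> \<in> K (int i - 1) \<and> \<eta>' \<in> K (int i) \<and>
        (\<exists>\<delta> S. \<eta> = (int i - 1, \<delta>, S) \<and> \<eta>' = (int i, \<delta>, S))
      \<longleftrightarrow> (\<eta>, \<eta>') \<in> layer_arcs n flo fhi d i \<and> idle_arc (\<eta>, \<eta>')" for \<eta> \<eta>'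
  proof -
    have "(\<eta>, \<eta>') \<in> A \<and> \<eta> \<in> K (int i - 1) \<and> \<eta>' \<in> K (int i) \<longleftrightarrow> (\<eta>, \<eta>') \<in> layer_arcs n flo fhi d i"
      using network_arcs_at_layer[OF \<open>i \<le> n\<close>] E_sub[of n flo fhi d i] unfolding K A_def by blast
    moreover have "(\<exists>\<delta> S. \<eta> = (int i - 1, \<delta>, S) \<and> \<eta>' = (int i, \<delta>, S)) \<longleftrightarrow> idle_arc (\<eta>, \<eta>')"
      if "(\<eta>, \<eta>') \<in> layer_arcs n flo fhi d i"
      using that by (cases \<eta>; cases \<eta>') (auto simp: layer_arcs_def mem_step_arcs_iff idle_arc_def)
    ultimately show ?thesis by blast
  qed
  then show ?thesis by (intro sum.cong) auto
qed

lemma displacement_sum_eq: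
  fixes n flo fhi d
  defines "K \<equiv> layer n flo fhi d" and "A \<equiv> network_arcs n flo fhi d"
  assumes "i \<le> n"
  shows "(\<Sum>((k, \<delta>, S), (k', \<delta>', S')) \<in> A \<inter> (K (int i - 1) \<times> K (int i)).
      (\<delta>' - \<delta>) * Y ((k, \<delta>, S), (k', \<delta>', S')))
    = (\<Sum>a\<in>layer_arcs n flo fhi d i. (node_sum (snd a) - node_sum (fst a)) * Y a)"
proof (rule sum.cong)
  have K: "K (int i - 1) = layers n flo fhi d i" "K (int i) = layers n flo fhi d (Suc i)"
    using \<open>i \<le> n\<close> layer_of_nat_minus_1[of i n] layer_of_nat[of i n] unfolding K_def by simp_all
  show "A \<inter> (K (int i - 1) \<times> K (int i)) = layer_arcs n flo fhi d i"
    using network_arcs_at_layer[OF \<open>i \<le> n\<close>] E_sub[of n flo fhi d i] unfolding K A_def by blast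
qed auto

theorem proposition3:
  fixes n :: nat and flo fhi :: "nat \<Rightarrow> real" and d :: real
    and K :: "int \<Rightarrow> node set" and A :: "(node \<times> node) set"
  assumes fhi_pos: "\<forall>j\<in>{1..n}. fhi j > 0"
    and flo_eq: "\<forall>j\<in>{1..n}. flo j = - fhi j"
    and bounds_0: "flo 0 \<le> fhi 0"
    and K_eq: "K = layer n flo fhi d"
    and A_eq: "A = network_arcs n flo fhi d"
  shows "convex hull (flow_set n flo fhi d) =
    {(x, f). x \<in> vectors_on {1..n} \<and> (\<forall>i\<in>{1..n}. 0 \<le> x i \<and> x i \<le> 1) \<and>
             f \<in> vectors_on {0..n} \<and>
       (\<exists>Y :: node \<times> node \<Rightarrow> real.
          (\<forall>a\<in>A. Y a \<ge> 0) \<and>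
          (\<Sum>\<eta> | \<eta> \<in> K 0 \<and> (source, \<eta>) \<in> A. Y (source, \<eta>)) = 1 \<and>
          (\<forall>i<n. \<forall>\<eta>'\<in>K (int i).
             (\<Sum>\<eta> | \<eta> \<in> K (int i - 1) \<and> (\<eta>, \<eta>') \<in> A. Y (\<eta>, \<eta>')) =
             (\<Sum>\<eta>'' | \<eta>'' \<in> K (int i + 1) \<and> (\<eta>', \<eta>'') \<in> A. Y (\<eta>', \<eta>''))) \<and>
          (\<forall>i\<in>{1..n}. x i = 1 -
             (\<Sum>(\<eta>, \<eta>') | (\<eta>, \<eta>') \<in> A \<and> \<eta> \<in> K (int i - 1) \<and> \<eta>' \<in> K (int i) \<and>
                (\<exists>\<delta> S. \<eta> = (int i - 1, \<delta>, S) \<and> \<eta>' = (int i, \<delta>, S)). Y (\<eta>, \<eta>'))) \<and>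
          (\<forall>i\<in>{0..n}. f i =
             (\<Sum>((k, \<delta>, S), (k', \<delta>', S')) \<in> A \<inter> (K (int i - 1) \<times> K (int i)).
                (\<delta>' - \<delta>) * Y ((k, \<delta>, S), (k', \<delta>', S')))))}"
proof -
  interpret symmetric_flow_bounds n flo fhi
    using fhi_pos flo_eq bounds_0 by unfold_locales
  let ?v = "flow_vector n flo fhi d arc_vector (Suc n)" and ?flow = "unit_flow n flo fhi d (Suc n)"
  let ?X = "\<lambda>Y i. 1 - (\<Sum>a | a \<in> layer_arcs n flo fhi d i \<and> idle_arc a. Y a)"
  let ?F = "\<lambda>Y i. \<Sum>a\<in>layer_arcs n flo fhi d i. (node_sum (snd a) - node_sum (fst a)) * Y a"
  have hull_iff: "(x, f) \<in> ?v ` {Y. ?flow Y} \<longleftrightarrow>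
      x \<in> vectors_on {1..n} \<and> (\<forall>i\<in>{1..n}. 0 \<le> x i \<and> x i \<le> 1) \<and> f \<in> vectors_on {0..n} \<and>
      (\<exists>Y. ?flow Y \<and> (\<forall>i\<in>{1..n}. x i = ?X Y i) \<and> (\<forall>i\<in>{0..n}. f i = ?F Y i))" for x f
  proof -
    have unit_interval: "0 \<le> ?X Y i \<and> ?X Y i \<le> 1" if "?flow Y" "i \<in> {1..n}" for Y i
      using idle_and_busy_flow[OF that(1), of i] that(2) by simp
    have "(x, f) \<in> ?v ` {Y. ?flow Y} \<longleftrightarrow> (\<exists>Y. ?flow Y \<and> (x, f) = ?v Y)" by blast
    also have "\<dots> \<longleftrightarrow> (\<exists>Y. ?flow Y \<and> x \<in> vectors_on {1..n} \<and> f \<in> vectors_on {0..n} \<and>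
        (\<forall>i\<in>{1..n}. x i = ?X Y i) \<and> (\<forall>i\<in>{0..n}. f i = ?F Y i))"
      using eq_flow_vector_iff[of n flo fhi d _ x f] by (intro arg_cong[of _ _ Ex] ext) blast
    also have "\<dots> \<longleftrightarrow> x \<in> vectors_on {1..n} \<and> (\<forall>i\<in>{1..n}. 0 \<le> x i \<and> x i \<le> 1) \<and>
        f \<in> vectors_on {0..n} \<and>
        (\<exists>Y. ?flow Y \<and> (\<forall>i\<in>{1..n}. x i = ?X Y i) \<and> (\<forall>i\<in>{0..n}. f i = ?F Y i))"
    proof (intro iffI; elim exE conjE)
      fix Y assume "?flow Y" and x: "\<forall>i\<in>{1..n}. x i = ?X Y i"
      then have "\<forall>i\<in>{1..n}. 0 \<le> x i \<and> x i \<le> 1"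
        using unit_interval by simp
      moreover assume "x \<in> vectors_on {1..n}" "f \<in> vectors_on {0..n}" "\<forall>i\<in>{0..n}. f i = ?F Y i"
      ultimately show "x \<in> vectors_on {1..n} \<and> (\<forall>i\<in>{1..n}. 0 \<le> x i \<and> x i \<le> 1) \<and>
        f \<in> vectors_on {0..n} \<and>
        (\<exists>Y. ?flow Y \<and> (\<forall>i\<in>{1..n}. x i = ?X Y i) \<and> (\<forall>i\<in>{0..n}. f i = ?F Y i))"
        using \<open>?flow Y\<close> x by blast
    qed blast
    finally show ?thesis .
  qed
  have idle: "(\<forall>i\<in>{1..n}. x i = 1 -
      (\<Sum>(\<eta>, \<eta>') | (\<eta>, \<eta>') \<in> A \<and> \<eta> \<in> K (int i - 1) \<and> \<eta>' \<in> K (int i) \<and>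
        (\<exists>\<delta> S. \<eta> = (int i - 1, \<delta>, S) \<and> \<eta>' = (int i, \<delta>, S)). Y (\<eta>, \<eta>')))
      \<longleftrightarrow> (\<forall>i\<in>{1..n}. x i = ?X Y i)" for x :: "nat \<Rightarrow> real" and Y
    unfolding K_eq A_eq by (intro ball_cong refl) (subst idle_sum_eq, auto)
  have displacement: "(\<forall>i\<in>{0..n}. f i =
      (\<Sum>((k, \<delta>, S), (k', \<delta>', S')) \<in> A \<inter> (K (int i - 1) \<times> K (int i)).
        (\<delta>' - \<delta>) * Y ((k, \<delta>, S), (k', \<delta>', S'))))
      \<longleftrightarrow> (\<forall>i\<in>{0..n}. f i = ?F Y i)" for f :: "nat \<Rightarrow> real" and Y
    unfolding K_eq A_eq by (intro ball_cong refl) (subst displacement_sum_eq, auto)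
  show ?thesis
    unfolding convex_hull_flow_set set_eq_iff split_paired_All mem_Collect_eq prod.case hull_iff
      idle displacement
    unfolding K_eq A_eq unit_flow_iff_network_constraints conj_assoc
    by (intro allI refl)
qed

end
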